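(* Let $\mathscr{L} f = \sqrt{p^2+1}\,\partial_p\big(\sqrt{p^2+1}\,\partial_p f\big) - p\,\partial_y f - \sqrt{p^2+1}\,\partial_t f$ on $\mathbb{R}^3\ni(p,y,t)$, and define on $\mathbb{R}^3$ the operation $$(p_0,y_0,t_0)\circ_{\mathcal{L}}(p,y,t)=\Big(p\sqrt{p_0^2+1}+p_0\sqrt{p^2+1},\ y_0+y\sqrt{p_0^2+1}+p_0t,\ t_0+t\sqrt{p_0^2+1}+p_0y\Big).$$ Then $(\mathbb{R}^3,\circ_{\mathcal{L}})$ is a Lie group with identity $(0,0,0)$ and inverse $$(p,y,t)^{-1}=\Big(-p,\ pt-\frac{y}{\sqrt{p^2+1}}-\frac{p^2y}{\sqrt{p^2+1}},\ -t\sqrt{p^2+1}+py\Big),$$ and $\mathscr{L}$ is invariant with respect to its left translations: for every $z_0\in\mathbb{R}^3$, every $f\in C^2(\mathbb{R}^3)$ and every $f^*\in C(\mathbb{R}^3)$, setting $g(z)=f(z_0\circ_{\mathcal{L}}z)$ and $g^*(z)=f^*(z_0\circ_{\mathcal{L}}z)$, one has $$\mathscr{L}f=f^*\ \text{ in }\mathbb{R}^3\quad\Longleftrightarrow\quad\mathscr{L}g=g^*\ \text{ in }\mathbb{R}^3.$$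
   Context: The left translation by $(p_0,y_0,t_0)$ is, up to a space-time translation, the one-dimensional Lorentz transformation acting on the vectors $(t,y)$ and $(\sqrt{p^2+1},p)$. *)

theory Defs
  imports "HOL-Analysis.Analysis" "HOL-Algebra.Group"
begin

text \<open>Points of \<open>\<real>\<^sup>3\<close> are triples \<open>(p, y, t)\<close>.\<close>

type_synonym point = "real \<times> real \<times> real"

text \<open>The class \<open>C\<^sup>k\<close> on the whole space. For a Euclidean domain this is equivalent to continuity of
  all partial derivatives of order at most \<open>k\<close>.\<close>

fun Ck :: "nat \<Rightarrow> ('a::real_normed_vector \<Rightarrow> 'b::real_normed_vector) \<Rightarrow> bool" where
  "Ck 0 f \<longleftrightarrow> continuous_on UNIV f"
| "Ck (Suc k) f \<longleftrightarrow> (\<forall>x. f differentiable (at x)) \<and>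
     (\<forall>v. Ck k (\<lambda>x. frechet_derivative f (at x) v))"

definition smooth :: "('a::real_normed_vector \<Rightarrow> 'b::real_normed_vector) \<Rightarrow> bool" where
  "smooth f \<longleftrightarrow> (\<forall>k. Ck k f)"

text \<open>A Lie group whose underlying manifold is a whole Euclidean space with its standard smooth
  structure.\<close>

definition euclidean_lie_group :: "'a::euclidean_space monoid \<Rightarrow> bool" where
  "euclidean_lie_group G \<longleftrightarrow> group G \<and> carrier G = UNIV \<and>
     smooth (\<lambda>(x, y). x \<otimes>\<^bsub>G\<^esub> y) \<and> smooth (\<lambda>x. inv\<^bsub>G\<^esub> x)"

fun opL :: "point \<Rightarrow> point \<Rightarrow> point" (infixl "\<circ>\<^sub>L" 70) where
  "(p0, y0, t0) \<circ>\<^sub>L (p, y, t) =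
     (p * sqrt (p0\<^sup>2 + 1) + p0 * sqrt (p\<^sup>2 + 1),
      y0 + y * sqrt (p0\<^sup>2 + 1) + p0 * t,
      t0 + t * sqrt (p0\<^sup>2 + 1) + p0 * y)"

definition groupL :: "point monoid" where
  "groupL = \<lparr>carrier = UNIV, mult = (\<circ>\<^sub>L), one = (0, 0, 0)\<rparr>"

definition partial_p :: "(point \<Rightarrow> real) \<Rightarrow> point \<Rightarrow> real" where
  "partial_p f = (\<lambda>(p, y, t). deriv (\<lambda>s. f (s, y, t)) p)"

definition partial_y :: "(point \<Rightarrow> real) \<Rightarrow> point \<Rightarrow> real" where
  "partial_y f = (\<lambda>(p, y, t). deriv (\<lambda>s. f (p, s, t)) y)"

definition partial_t :: "(point \<Rightarrow> real) \<Rightarrow> point \<Rightarrow> real" where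
  "partial_t f = (\<lambda>(p, y, t). deriv (\<lambda>s. f (p, y, s)) t)"

definition operatorL :: "(point \<Rightarrow> real) \<Rightarrow> point \<Rightarrow> real" where
  "operatorL f = (\<lambda>(p, y, t).
     sqrt (p\<^sup>2 + 1) * partial_p (\<lambda>(q, v, s). sqrt (q\<^sup>2 + 1) * partial_p f (q, v, s)) (p, y, t)
     - p * partial_y f (p, y, t)
     - sqrt (p\<^sup>2 + 1) * partial_t f (p, y, t))"

end

theory Submission
  imports Defs
begin

text \<open>With \<open>p = sinh \<theta>\<close>, the first coordinate of a left translation adds rapidities, so
  \<open>X = sqrt (p\<^sup>2 + 1) \<partial>\<^sub>p = \<partial>\<^sub>\<theta>\<close> commutes with left translations. The
  remaining coordinates undergo a Lorentz transformation, which also acts on the vector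
  \<open>(sqrt (p\<^sup>2 + 1), p)\<close>, so the field \<open>p \<partial>\<^sub>y + sqrt (p\<^sup>2 + 1) \<partial>\<^sub>t\<close> commutes
  with left translations as well.\<close>

section \<open>Calculus of \<open>C\<^sup>k\<close> maps\<close>

text \<open>Derivatives are unique, so any explicit formula \<open>D\<close> may replace the choice
  operator \<open>frechet_derivative\<close>. The inductions below then recurse on concrete
  expressions.\<close>

lemma Ck_SucI:
  assumes "\<And>x. (f has_derivative D x) (at x)" and "\<And>v. Ck k (\<lambda>x. D x v)"
  shows "Ck (Suc k) f"
proof -
  have "frechet_derivative f (at x) = D x" for x
    using assms(1) frechet_derivative_at by metis
  then show ?thesis
    using assms by (auto simp: differentiable_def)
qed

lemma Ck_Suc_has_derivative:
  assumes "Ck (Suc k) f"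
  shows "(f has_derivative frechet_derivative f (at x)) (at x)"
  using assms frechet_derivative_works by auto

text \<open>The product rule leaves undifferentiated factors in the derivative; this lowers their
  order to the one the induction hypothesis needs.\<close>

lemma Ck_Suc_imp_Ck: "Ck (Suc k) f \<Longrightarrow> Ck k f"
proof (induction k arbitrary: f)
  case 0
  then show ?case
    by (auto intro!: differentiable_imp_continuous_on simp: differentiable_on_def)
next
  case (Suc k)
  have "\<forall>x. f differentiable (at x)"
    and "\<forall>v. Ck (Suc k) (\<lambda>x. frechet_derivative f (at x) v)"
    using Suc.prems unfolding Ck.simps(2)[of "Suc k"] by blast+
  then show ?case
    using Suc.IH unfolding Ck.simps(2)[of k f] by blast
qed

lemma Ck_const: "Ck k (\<lambda>x. c)"
  by (induction k arbitrary: c)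
     (auto intro!: Ck_SucI[where D = "\<lambda>x v. 0"] simp del: Ck.simps(2))

lemma Ck_bounded_linear_compose:
  assumes "bounded_linear L"
  shows "Ck k f \<Longrightarrow> Ck k (\<lambda>x. L (f x))"
proof (induction k arbitrary: f)
  case 0
  then show ?case
    using bounded_linear.continuous_on[OF assms] by simp
next
  case (Suc k)
  show ?case
  proof (rule Ck_SucI)
    show "((\<lambda>x. L (f x)) has_derivative (\<lambda>v. L (frechet_derivative f (at x) v))) (at x)" for x
      using bounded_linear.has_derivative[OF assms Ck_Suc_has_derivative[OF Suc.prems]] .
    show "Ck k (\<lambda>x. L (frechet_derivative f (at x) v))" for v
      using Suc by simp
  qed
qed

lemma Ck_bounded_linear:
  assumes "bounded_linear L"
  shows "Ck k L"
proof (cases k)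
  case 0
  then show ?thesis
    using assms by (simp add: linear_continuous_on)
next
  case (Suc m)
  show ?thesis unfolding Suc
    by (rule Ck_SucI[where D = "\<lambda>x. L"])
       (auto intro: bounded_linear_imp_has_derivative assms Ck_const)
qed

lemma Ck_add: "Ck k f \<Longrightarrow> Ck k g \<Longrightarrow> Ck k (\<lambda>x. f x + g x)"
proof (induction k arbitrary: f g)
  case 0
  then show ?case by (simp add: continuous_on_add)
next
  case (Suc k)
  show ?case
  proof (rule Ck_SucI)
    show "((\<lambda>x. f x + g x) has_derivative
        (\<lambda>v. frechet_derivative f (at x) v + frechet_derivative g (at x) v)) (at x)" for x
      by (intro has_derivative_add Ck_Suc_has_derivative[OF Suc.prems(1)]
          Ck_Suc_has_derivative[OF Suc.prems(2)])
    show "Ck k (\<lambda>x. frechet_derivative f (at x) v + frechet_derivative g (at x) v)" for v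
      using Suc by simp
  qed
qed

lemma Ck_mult:
  fixes f g :: "'a::real_normed_vector \<Rightarrow> real"
  shows "Ck k f \<Longrightarrow> Ck k g \<Longrightarrow> Ck k (\<lambda>x. f x * g x)"
proof (induction k arbitrary: f g)
  case 0
  then show ?case by (simp add: continuous_on_mult)
next
  case (Suc k)
  show ?case
  proof (rule Ck_SucI)
    show "((\<lambda>x. f x * g x) has_derivative
        (\<lambda>v. f x * frechet_derivative g (at x) v + frechet_derivative f (at x) v * g x)) (at x)" for x
      by (intro has_derivative_mult Ck_Suc_has_derivative[OF Suc.prems(1)]
          Ck_Suc_has_derivative[OF Suc.prems(2)])
    show "Ck k (\<lambda>x. f x * frechet_derivative g (at x) v + frechet_derivative f (at x) v * g x)" for v
      using Suc by (intro Ck_add Suc.IH Ck_Suc_imp_Ck[OF Suc.prems(1)]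
          Ck_Suc_imp_Ck[OF Suc.prems(2)]) simp_all
  qed
qed

lemma Ck_minus: "Ck k f \<Longrightarrow> Ck k (\<lambda>x. - f x)"
  by (rule Ck_bounded_linear_compose[OF bounded_linear_minus[OF bounded_linear_ident]])

lemma Ck_diff: "Ck k f \<Longrightarrow> Ck k g \<Longrightarrow> Ck k (\<lambda>x. f x - g x)"
  using Ck_add[of k f "\<lambda>x. - g x"] Ck_minus[of k g] by simp

lemma Ck_Pair:
  assumes "Ck k f" and "Ck k g"
  shows "Ck k (\<lambda>x. (f x, g x))"
proof -
  \<comment> \<open>A pair is a sum of two bounded linear embeddings, so the earlier closure rules
    suffice.\<close>
  have "Ck k (\<lambda>x. (f x, 0) + (0, g x))"
    by (intro Ck_add Ck_bounded_linear_compose[OF _ assms(1)] Ck_bounded_linear_compose[OF _ assms(2)]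
        bounded_linear_Pair bounded_linear_ident bounded_linear_zero)
  then show ?thesis by simp
qed

section \<open>Smoothness of \<open>sqrt (u^2 + 1)\<close>\<close>

lemma DERIV_sqrt_square_plus_one:
  "((\<lambda>u. sqrt (u\<^sup>2 + 1)) has_real_derivative u / sqrt (u\<^sup>2 + 1)) (at u)"
proof -
  have "((\<lambda>u. u\<^sup>2 + 1) has_real_derivative 2 * u) (at u)"
    by (auto intro!: derivative_eq_intros)
  moreover have "u\<^sup>2 + 1 > 0"
    by (simp add: add_nonneg_pos)
  ultimately show ?thesis
    using DERIV_chain2[OF DERIV_real_sqrt] by (fastforce simp: field_simps)
qed

text \<open>The reciprocal \<open>r\<close> has derivative \<open>- h * h' * r^3\<close>, a
  polynomial in \<open>h\<close>, \<open>h'\<close> and \<open>r\<close> itself. The induction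
  therefore closes with products alone, without a general composition rule for
  \<open>Ck\<close>.\<close>

lemma Ck_inverse_sqrt_square_plus_one:
  fixes h :: "'a::real_normed_vector \<Rightarrow> real"
  shows "Ck k h \<Longrightarrow> Ck k (\<lambda>x. 1 / sqrt ((h x)\<^sup>2 + 1))"
proof (induction k)
  case 0
  have "(h x)\<^sup>2 + 1 \<noteq> 0" for x
    by (metis add_nonneg_pos less_irrefl zero_le_power2 zero_less_one)
  with 0 show ?case by (auto intro!: continuous_intros)
next
  case (Suc k)
  define r where "r = (\<lambda>x. 1 / sqrt ((h x)\<^sup>2 + 1))"
  let ?h' = "\<lambda>x. frechet_derivative h (at x)"
  have r: "Ck k r"
    using Suc.IH[OF Ck_Suc_imp_Ck[OF Suc.prems]] by (simp add: r_def)
  have "Ck (Suc k) r"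
  proof (rule Ck_SucI)
    fix x
    have pos: "(h x)\<^sup>2 + 1 > 0"
      by (simp add: add_nonneg_pos)
    \<comment> \<open>Splits the denominator coming from the derivative of an inverse into two
      factors \<open>r\<close>, which makes the result cubic in \<open>r\<close>.\<close>
    have "inverse ((h x)\<^sup>2 + 1)
        = inverse (sqrt ((h x)\<^sup>2 + 1)) * inverse (sqrt ((h x)\<^sup>2 + 1))"
      using pos by (simp flip: inverse_mult_distrib)
    then have "((\<lambda>u. inverse (sqrt (u\<^sup>2 + 1))) has_real_derivative
        - (h x * (r x * (r x * r x)))) (at (h x))"
      using DERIV_inverse_fun[OF DERIV_sqrt_square_plus_one[of "h x"]] pos
      by (simp add: r_def divide_inverse mult_ac)
    from DERIV_compose_FDERIV[OF this Ck_Suc_has_derivative[OF Suc.prems]]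
    show "(r has_derivative (\<lambda>v. ?h' x v * - (h x * (r x * (r x * r x))))) (at x)"
      by (simp add: r_def inverse_eq_divide)
  next
    show "Ck k (\<lambda>x. ?h' x v * - (h x * (r x * (r x * r x))))" for v
      using Suc.prems by (intro Ck_mult Ck_minus r Ck_Suc_imp_Ck[OF Suc.prems]) simp
  qed
  then show ?case by (simp add: r_def)
qed

lemma Ck_sqrt_square_plus_one:
  fixes h :: "'a::real_normed_vector \<Rightarrow> real"
  assumes "Ck k h"
  shows "Ck k (\<lambda>x. sqrt ((h x)\<^sup>2 + 1))"
proof -
  have "Ck k (\<lambda>x. (h x * h x + 1) * (1 / sqrt ((h x)\<^sup>2 + 1)))"
    by (intro Ck_mult Ck_add Ck_const assms Ck_inverse_sqrt_square_plus_one)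
  moreover have "(u * u + 1) * (1 / sqrt (u\<^sup>2 + 1)) = sqrt (u\<^sup>2 + 1)" for u :: real
    by (simp add: real_div_sqrt add_nonneg_nonneg flip: power2_eq_square)
  ultimately show ?thesis by simp
qed

section \<open>The group structure\<close>

text \<open>The addition formula for cosh: if \<open>p = sinh a\<close> and
  \<open>q = sinh b\<close>, the squared term is \<open>sinh (a + b)\<close> and the right-hand side
  is \<open>cosh a * cosh b + sinh a * sinh b\<close>.\<close>

lemma sqrt_square_plus_one_boost:
  fixes p q :: real
  shows "sqrt ((p * sqrt (q\<^sup>2 + 1) + q * sqrt (p\<^sup>2 + 1))\<^sup>2 + 1)
    = sqrt (p\<^sup>2 + 1) * sqrt (q\<^sup>2 + 1) + p * q"
proof (rule real_sqrt_unique)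
  \<comment> \<open>Each root dominates the absolute value of its argument, which gives the sign
    condition for taking the root.\<close>
  have "\<bar>p\<bar> * \<bar>q\<bar> \<le> sqrt (p\<^sup>2 + 1) * sqrt (q\<^sup>2 + 1)"
    by (intro mult_mono) (auto intro!: real_le_rsqrt)
  moreover have "- (p * q) \<le> \<bar>p\<bar> * \<bar>q\<bar>"
    by (metis abs_ge_minus_self abs_mult)
  ultimately show "0 \<le> sqrt (p\<^sup>2 + 1) * sqrt (q\<^sup>2 + 1) + p * q"
    by linarith
  have "(sqrt (p\<^sup>2 + 1))\<^sup>2 = p\<^sup>2 + 1" "(sqrt (q\<^sup>2 + 1))\<^sup>2 = q\<^sup>2 + 1"
    by (simp_all add: add_nonneg_nonneg)
  then show "(sqrt (p\<^sup>2 + 1) * sqrt (q\<^sup>2 + 1) + p * q)\<^sup>2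
      = (p * sqrt (q\<^sup>2 + 1) + q * sqrt (p\<^sup>2 + 1))\<^sup>2 + 1"
    by algebra
qed

text \<open>Once the addition formula removes the nested roots, both sides agree as polynomials in
  the coordinates and the remaining roots.\<close>

lemma opL_assoc: "(x \<circ>\<^sub>L y) \<circ>\<^sub>L z = x \<circ>\<^sub>L (y \<circ>\<^sub>L z)"
  by (cases x; cases y; cases z) (simp add: sqrt_square_plus_one_boost, simp add: algebra_simps)

definition invL :: "point \<Rightarrow> point" where
  "invL = (\<lambda>(p, y, t).
     (- p,
      p * t - y / sqrt (p\<^sup>2 + 1) - p\<^sup>2 * y / sqrt (p\<^sup>2 + 1),
      - t * sqrt (p\<^sup>2 + 1) + p * y))"

text \<open>A division-free form, convenient for smoothness: the last two coordinates are the boost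
  by \<open>- p\<close> applied to \<open>(- y, - t)\<close>.\<close>

lemma invL_eq:
  "invL (p, y, t) = (- p, p * t - y * sqrt (p\<^sup>2 + 1), p * y - t * sqrt (p\<^sup>2 + 1))"
proof -
  have "y / sqrt (p\<^sup>2 + 1) + p\<^sup>2 * y / sqrt (p\<^sup>2 + 1) = y * ((p\<^sup>2 + 1) / sqrt (p\<^sup>2 + 1))"
    by (simp add: algebra_simps add_divide_distrib)
  also have "\<dots> = y * sqrt (p\<^sup>2 + 1)"
    by (simp add: real_div_sqrt add_nonneg_nonneg)
  finally show ?thesis
    by (simp add: invL_def algebra_simps)
qed

lemma invL_opL: "invL x \<circ>\<^sub>L x = (0, 0, 0)"
  by (cases x) (simp add: invL_eq algebra_simps)

text \<open>Here the cancellation relies on the square of the root being \<open>p^2 + 1\<close>. The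
  identity later gives surjectivity of left translations.\<close>

lemma opL_invL: "x \<circ>\<^sub>L invL x = (0, 0, 0)"
proof (cases x)
  case (fields p y t)
  have "(sqrt (p\<^sup>2 + 1))\<^sup>2 = p\<^sup>2 + 1"
    by (simp add: add_nonneg_nonneg)
  then have "sqrt (p\<^sup>2 + 1) * (sqrt (p\<^sup>2 + 1) * u) = (p\<^sup>2 + 1) * u" for u
    by (simp add: power2_eq_square mult.assoc[symmetric])
  then show ?thesis
    unfolding fields invL_eq opL.simps prod.inject power2_minus
    by (simp add: algebra_simps power2_eq_square)
qed

lemma group_groupL: "group groupL"
proof (rule groupI)
  show "\<exists>y\<in>carrier groupL. y \<otimes>\<^bsub>groupL\<^esub> x = \<one>\<^bsub>groupL\<^esub>" for x
    using invL_opL[of x] by (auto simp: groupL_def simp del: opL.simps split_paired_Ex)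
qed (auto simp: groupL_def opL_assoc simp del: opL.simps, simp)

lemma inv_groupL: "inv\<^bsub>groupL\<^esub> x = invL x"
  using group.inv_equality[OF group_groupL, of "invL x" x] invL_opL[of x]
  by (simp add: groupL_def)

section \<open>Smoothness of product and inverse\<close>

lemma Ck_opL: "Ck k (\<lambda>(x, y). x \<circ>\<^sub>L y)"
proof -
  \<comment> \<open>Writing coordinates as projections exposes sums, products and roots of linear
    maps, to which the closure rules apply syntactically.\<close>
  have "(\<lambda>(x, y). x \<circ>\<^sub>L y) = (\<lambda>z.
      (fst (snd z) * sqrt ((fst (fst z))\<^sup>2 + 1) + fst (fst z) * sqrt ((fst (snd z))\<^sup>2 + 1),
       fst (snd (fst z)) + fst (snd (snd z)) * sqrt ((fst (fst z))\<^sup>2 + 1)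
         + fst (fst z) * snd (snd (snd z)),
       snd (snd (fst z)) + snd (snd (snd z)) * sqrt ((fst (fst z))\<^sup>2 + 1)
         + fst (fst z) * fst (snd (snd z))))"
    by auto
  then show ?thesis
    by (simp only:) (intro Ck_Pair Ck_add Ck_mult Ck_sqrt_square_plus_one;
        intro Ck_bounded_linear bounded_linear_fst_comp bounded_linear_snd_comp
          bounded_linear_fst bounded_linear_snd bounded_linear_ident)
qed

lemma Ck_invL: "Ck k invL"
proof -
  have eq: "invL = (\<lambda>z.
      (- fst z,
       fst z * snd (snd z) - fst (snd z) * sqrt ((fst z)\<^sup>2 + 1),
       fst z * fst (snd z) - snd (snd z) * sqrt ((fst z)\<^sup>2 + 1)))"
    by (auto simp: invL_eq)
  show ?thesis
    unfolding eq by (intro Ck_Pair Ck_diff Ck_minus Ck_mult Ck_sqrt_square_plus_one;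
        intro Ck_bounded_linear bounded_linear_fst_comp bounded_linear_snd_comp
          bounded_linear_fst bounded_linear_snd bounded_linear_ident)
qed

lemma euclidean_lie_group_groupL: "euclidean_lie_group groupL"
proof -
  have "(\<lambda>(x, y). x \<otimes>\<^bsub>groupL\<^esub> y) = (\<lambda>(x, y). x \<circ>\<^sub>L y)"
    by (simp add: groupL_def)
  moreover have "(\<lambda>x. inv\<^bsub>groupL\<^esub> x) = invL"
    by (auto simp: inv_groupL)
  ultimately show ?thesis
    using group_groupL Ck_opL Ck_invL
    by (simp add: euclidean_lie_group_def smooth_def) (simp add: groupL_def)
qed

section \<open>Invariance of the operator\<close>

lemma has_real_derivative_along_curve:
  fixes f :: "point \<Rightarrow> real"
  assumes f: "f differentiable (at (a s, b s, c s))"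
    and a: "(a has_real_derivative a') (at s)"
    and b: "(b has_real_derivative b') (at s)"
    and c: "(c has_real_derivative c') (at s)"
  shows "((\<lambda>s. f (a s, b s, c s)) has_real_derivative
    a' * partial_p f (a s, b s, c s) + b' * partial_y f (a s, b s, c s)
      + c' * partial_t f (a s, b s, c s)) (at s)"
proof -
  let ?z = "(a s, b s, c s)"
  define D where "D = frechet_derivative f (at ?z)"
  have D: "(f has_derivative D) (at ?z)"
    using f frechet_derivative_works D_def by blast
  have lin: "linear D"
    using D has_derivative_linear by blast
  \<comment> \<open>Stated for every curve through \<open>?z\<close>: coordinate lines identify the
    partial derivatives with values of \<open>D\<close>, and the given curve yields the
    conclusion.\<close>
  have chain: "((\<lambda>s. f (a s, b s, c s)) has_real_derivative D (a', b', c')) (at s)"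
    if "(a has_real_derivative a') (at s)" "(b has_real_derivative b') (at s)"
       "(c has_real_derivative c') (at s)" "?z = (a s, b s, c s)"
    for a b c :: "real \<Rightarrow> real" and a' b' c' s
  proof -
    have "((\<lambda>s. (a s, b s, c s)) has_derivative (\<lambda>h. (a' * h, b' * h, c' * h))) (at s)"
      using that by (intro has_derivative_Pair) (simp_all add: has_field_derivative_def)
    from has_derivative_compose[OF this D[unfolded that(4)]]
    have "((\<lambda>s. f (a s, b s, c s)) has_derivative (\<lambda>h. D (a' * h, b' * h, c' * h))) (at s)" .
    moreover have "D (a' * h, b' * h, c' * h) = D (a', b', c') * h" for h
      using linear_scale[OF lin, of h "(a', b', c')"] by (simp add: mult.commute)
    ultimately show ?thesis
      by (simp add: has_field_derivative_def)
  qed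
  have "partial_p f ?z = D (1, 0, 0)"
    unfolding partial_p_def prod.case
    by (rule DERIV_imp_deriv, rule chain) (auto intro!: derivative_eq_intros)
  moreover have "partial_y f ?z = D (0, 1, 0)"
    unfolding partial_y_def prod.case
    by (rule DERIV_imp_deriv, rule chain) (auto intro!: derivative_eq_intros)
  moreover have "partial_t f ?z = D (0, 0, 1)"
    unfolding partial_t_def prod.case
    by (rule DERIV_imp_deriv, rule chain) (auto intro!: derivative_eq_intros)
  moreover have "D (a', b', c') = D (a' *\<^sub>R (1, 0, 0) + b' *\<^sub>R (0, 1, 0) + c' *\<^sub>R (0, 0, 1))"
    by simp
  then have "D (a', b', c') = a' * D (1, 0, 0) + b' * D (0, 1, 0) + c' * D (0, 0, 1)"
    by (simp only: linear_add[OF lin] linear_scale[OF lin] real_scaleR_def)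
  ultimately show ?thesis
    using chain[OF a b c] by simp
qed

section \<open>The two vector fields composing the operator\<close>

definition fieldX :: "(point \<Rightarrow> real) \<Rightarrow> point \<Rightarrow> real" where
  "fieldX f = (\<lambda>(p, y, t). sqrt (p\<^sup>2 + 1) * partial_p f (p, y, t))"

definition fieldY :: "(point \<Rightarrow> real) \<Rightarrow> point \<Rightarrow> real" where
  "fieldY f = (\<lambda>(p, y, t). p * partial_y f (p, y, t) + sqrt (p\<^sup>2 + 1) * partial_t f (p, y, t))"

lemma operatorL_eq: "operatorL f z = fieldX (fieldX f) z - fieldY f z"
  by (cases z) (simp add: operatorL_def fieldX_def fieldY_def)

text \<open>Only the first coordinate of the translate depends on \<open>p\<close>, and its
  derivative times \<open>sqrt (p^2 + 1)\<close> is the root at the translated point. Assuming mere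
  differentiability allows a second use with \<open>fieldX f\<close> in place of
  \<open>f\<close>.\<close>

lemma fieldX_left_translate:
  assumes "\<And>z. f differentiable (at z)"
  shows "fieldX (\<lambda>z. f (z0 \<circ>\<^sub>L z)) z = fieldX f (z0 \<circ>\<^sub>L z)"
proof -
  obtain p0 y0 t0 where z0: "z0 = (p0, y0, t0)" by (cases z0)
  obtain p y t where z: "z = (p, y, t)" by (cases z)
  have pos: "p\<^sup>2 + 1 > 0"
    by (simp add: add_nonneg_pos)
  have "((\<lambda>s. s * sqrt (p0\<^sup>2 + 1) + p0 * sqrt (s\<^sup>2 + 1)) has_real_derivative
      sqrt (p0\<^sup>2 + 1) + p0 * (p / sqrt (p\<^sup>2 + 1))) (at p)"
    using DERIV_add[OF DERIV_cmult_right[OF DERIV_ident]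
        DERIV_cmult[OF DERIV_sqrt_square_plus_one[of p]]] by simp
  from DERIV_imp_deriv[OF has_real_derivative_along_curve[OF assms this DERIV_const DERIV_const]]
  have "partial_p (\<lambda>z. f (z0 \<circ>\<^sub>L z)) z
      = (sqrt (p0\<^sup>2 + 1) + p0 * (p / sqrt (p\<^sup>2 + 1))) * partial_p f (z0 \<circ>\<^sub>L z)"
    by (simp add: partial_p_def z z0)
  moreover have "sqrt (p\<^sup>2 + 1) * (sqrt (p0\<^sup>2 + 1) + p0 * (p / sqrt (p\<^sup>2 + 1)))
      = sqrt (p\<^sup>2 + 1) * sqrt (p0\<^sup>2 + 1) + p * p0"
    using pos by (simp add: field_simps)
  ultimately have "sqrt (p\<^sup>2 + 1) * partial_p (\<lambda>z. f (z0 \<circ>\<^sub>L z)) z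
      = (sqrt (p\<^sup>2 + 1) * sqrt (p0\<^sup>2 + 1) + p * p0) * partial_p f (z0 \<circ>\<^sub>L z)"
    by (metis mult.assoc)
  then show ?thesis
    by (simp add: fieldX_def z z0 sqrt_square_plus_one_boost)
qed

text \<open>The chain rule puts the boost matrix on the partial derivatives in \<open>y\<close> and
  \<open>t\<close>. Regrouped, their coefficients are the boosted \<open>p\<close> and the boosted
  root, by the addition formula.\<close>

lemma fieldY_left_translate:
  assumes "\<And>z. f differentiable (at z)"
  shows "fieldY (\<lambda>z. f (z0 \<circ>\<^sub>L z)) z = fieldY f (z0 \<circ>\<^sub>L z)"
proof -
  obtain p0 y0 t0 where z0: "z0 = (p0, y0, t0)" by (cases z0)
  obtain p y t where z: "z = (p, y, t)" by (cases z)
  let ?y = "\<lambda>s t. y0 + s * sqrt (p0\<^sup>2 + 1) + p0 * t"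
  let ?t = "\<lambda>t s. t0 + t * sqrt (p0\<^sup>2 + 1) + p0 * s"
  have "((\<lambda>s. ?y s t) has_real_derivative sqrt (p0\<^sup>2 + 1)) (at y)"
    and "(?t t has_real_derivative p0) (at y)"
    by (auto intro!: derivative_eq_intros)
  from DERIV_imp_deriv[OF has_real_derivative_along_curve[OF assms DERIV_const this]]
  have "partial_y (\<lambda>z. f (z0 \<circ>\<^sub>L z)) z
      = sqrt (p0\<^sup>2 + 1) * partial_y f (z0 \<circ>\<^sub>L z) + p0 * partial_t f (z0 \<circ>\<^sub>L z)"
    by (simp add: partial_y_def z z0)
  moreover have "(?y y has_real_derivative p0) (at t)"
    and "((\<lambda>s. ?t s y) has_real_derivative sqrt (p0\<^sup>2 + 1)) (at t)"
    by (auto intro!: derivative_eq_intros)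
  from DERIV_imp_deriv[OF has_real_derivative_along_curve[OF assms DERIV_const this]]
  have "partial_t (\<lambda>z. f (z0 \<circ>\<^sub>L z)) z
      = p0 * partial_y f (z0 \<circ>\<^sub>L z) + sqrt (p0\<^sup>2 + 1) * partial_t f (z0 \<circ>\<^sub>L z)"
    by (simp add: partial_t_def z z0)
  ultimately show ?thesis
    by (simp add: fieldY_def z z0 sqrt_square_plus_one_boost) (simp add: algebra_simps)
qed

text \<open>Second-order regularity enters here: \<open>partial_p f\<close> is the Frechet
  derivative in direction \<open>(1, 0, 0)\<close>, and \<open>Ck 2\<close> makes that directional
  derivative \<open>Ck 1\<close>.\<close>

lemma differentiable_fieldX:
  assumes "Ck 2 f"
  shows "fieldX f differentiable (at z)"
proof -
  have f: "Ck (Suc (Suc 0)) f"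
    using assms by (simp only: numeral_2_eq_2)
  then have diff: "f differentiable (at z)" for z
    by (simp del: split_paired_All)
  have "partial_p f z = frechet_derivative f (at z) (1, 0, 0)" for z
  proof (cases z)
    case (fields p y t)
    have "((\<lambda>s. (s, y, t)) has_derivative (\<lambda>h. (h, 0, 0))) (at p)"
      by (intro has_derivative_Pair has_derivative_ident has_derivative_const)
    from has_derivative_compose[OF this Ck_Suc_has_derivative[OF f]]
    have "((\<lambda>s. f (s, y, t)) has_derivative
        (\<lambda>h. frechet_derivative f (at (p, y, t)) (h, 0, 0))) (at p)" .
    moreover have "(\<lambda>h. frechet_derivative f (at (p, y, t)) (h, 0, 0))
        = (*) (frechet_derivative f (at (p, y, t)) (1, 0, 0))"
    proof
      show "frechet_derivative f (at (p, y, t)) (h, 0, 0)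
          = frechet_derivative f (at (p, y, t)) (1, 0, 0) * h" for h
        using linear_scale[OF linear_frechet_derivative[OF diff], of "(p, y, t)" h "(1, 0, 0)"]
        by (simp add: mult.commute)
    qed
    ultimately have "((\<lambda>s. f (s, y, t)) has_real_derivative
        frechet_derivative f (at (p, y, t)) (1, 0, 0)) (at p)"
      by (simp only: has_field_derivative_def)
    then show ?thesis
      by (simp add: partial_p_def fields DERIV_imp_deriv)
  qed
  then have "fieldX f = (\<lambda>z. sqrt ((fst z)\<^sup>2 + 1) * frechet_derivative f (at z) (1, 0, 0))"
    by (auto simp: fieldX_def)
  moreover have "Ck (Suc 0) (\<lambda>z. sqrt ((fst z)\<^sup>2 + 1) * frechet_derivative f (at z) (1, 0, 0))"
    using f unfolding Ck.simps(2)[of "Suc 0"]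
    by (intro Ck_mult Ck_sqrt_square_plus_one Ck_bounded_linear[OF bounded_linear_fst]) blast
  ultimately show ?thesis
    by (simp del: split_paired_All)
qed

lemma operatorL_left_translate:
  assumes "Ck 2 f"
  shows "operatorL (\<lambda>z. f (z0 \<circ>\<^sub>L z)) z = operatorL f (z0 \<circ>\<^sub>L z)"
proof -
  have diff: "f differentiable (at z)" for z
    using assms by (simp add: numeral_2_eq_2 del: split_paired_All)
  \<comment> \<open>An equality of functions is required, since the outer \<open>fieldX\<close>
    differentiates the inner one.\<close>
  have "fieldX (\<lambda>z. f (z0 \<circ>\<^sub>L z)) = (\<lambda>z. fieldX f (z0 \<circ>\<^sub>L z))"
    by (rule ext) (rule fieldX_left_translate[OF diff])
  then show ?thesis
    by (simp only: operatorL_eq fieldX_left_translate[OF differentiable_fieldX[OF assms]]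
        fieldY_left_translate[OF diff])
qed

lemma surj_left_translate: "surj (\<lambda>z. z0 \<circ>\<^sub>L z)"
proof (rule surjI)
  show "z0 \<circ>\<^sub>L (invL z0 \<circ>\<^sub>L z) = z" for z
    by (simp only: opL_invL flip: opL_assoc) (cases z, simp)
qed

theorem mainTheorem4:
  shows "euclidean_lie_group groupL
    \<and> \<one>\<^bsub>groupL\<^esub> = (0, 0, 0)
    \<and> (\<forall>p y t. inv\<^bsub>groupL\<^esub> (p, y, t) =
          (- p,
           p * t - y / sqrt (p\<^sup>2 + 1) - p\<^sup>2 * y / sqrt (p\<^sup>2 + 1),
           - t * sqrt (p\<^sup>2 + 1) + p * y))
    \<and> (\<forall>(z0 :: point) (f :: point \<Rightarrow> real) (f' :: point \<Rightarrow> real).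
          Ck 2 f \<longrightarrow> continuous_on UNIV f' \<longrightarrow>
          (let g = (\<lambda>z. f (z0 \<circ>\<^sub>L z)); g' = (\<lambda>z. f' (z0 \<circ>\<^sub>L z)) in
            (\<forall>z. operatorL f z = f' z) \<longleftrightarrow> (\<forall>z. operatorL g z = g' z)))"
proof (intro conjI allI impI)
  show "euclidean_lie_group groupL"
    by (rule euclidean_lie_group_groupL)
  show "\<one>\<^bsub>groupL\<^esub> = (0, 0, 0)"
    by (simp add: groupL_def)
  show "inv\<^bsub>groupL\<^esub> (p, y, t) =
      (- p,
       p * t - y / sqrt (p\<^sup>2 + 1) - p\<^sup>2 * y / sqrt (p\<^sup>2 + 1),
       - t * sqrt (p\<^sup>2 + 1) + p * y)" for p y t
    by (simp add: inv_groupL invL_def)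
next
  fix z0 :: point and f f' :: "point \<Rightarrow> real"
  assume f: "Ck 2 f"
  \<comment> \<open>Surjectivity of the translation gives the backward direction: every point has
    the form \<open>z0 \<circ>\<^sub>L z\<close>.\<close>
  have "(\<forall>z. operatorL f z = f' z) \<longleftrightarrow> (\<forall>z. operatorL f (z0 \<circ>\<^sub>L z) = f' (z0 \<circ>\<^sub>L z))"
    using surj_left_translate[of z0] by (metis surj_def)
  then show "let g = (\<lambda>z. f (z0 \<circ>\<^sub>L z)); g' = (\<lambda>z. f' (z0 \<circ>\<^sub>L z)) in
      (\<forall>z. operatorL f z = f' z) \<longleftrightarrow> (\<forall>z. operatorL g z = g' z)"
    by (simp only: Let_def operatorL_left_translate[OF f])
qed

end
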